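(* Let $\mathcal{H}$ be a real Hilbert space, let $f\in\Gamma_0(\mathcal{H})$ be Legendre, let $m\ge 1$, and let $\mathcal{S}=\{p_0,p_1,\dots,p_m\}\subseteq\operatorname{dom} f$. Suppose that $\overrightarrow{E}_f(\mathcal{S})\neq\varnothing$ and let $y\in\overrightarrow{E}_f(\mathcal{S})$. Set $M=\operatorname{span}\{p_1-p_0,\dots,p_m-p_0\}$. Then the following hold. (i) $\overrightarrow{CC}_f(\mathcal{S})=\operatorname{aff}(\mathcal{S})\cap\operatorname{int}\operatorname{dom} f\cap\nabla f^*\big(\nabla f(y)+M^{\perp}\big)$. (ii) Suppose that $\operatorname{aff}(\mathcal{S})\cap\operatorname{int}\operatorname{dom} f\neq\varnothing$ (for example, $\operatorname{dom} f=\mathcal{H}$ or $\mathcal{S}\cap\operatorname{int}\operatorname{dom} f\neq\varnothing$). Then $\overleftarrow{P}^{f}_{\operatorname{aff}(\mathcal{S})}(y)\in\overrightarrow{CC}_f(\mathcal{S})$.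
   Context: $\Gamma_0(\mathcal{H})$ is the set of proper closed convex functions $\mathcal{H}\to\,]-\infty,+\infty]$; $f^*$ is the Fenchel conjugate; $\operatorname{aff}$ denotes affine hull. $f\in\Gamma_0(\mathcal{H})$ is Legendre if it is essentially smooth ($\operatorname{dom}\partial f=\operatorname{int}\operatorname{dom} f\neq\varnothing$, $f$ is Gâteaux differentiable on $\operatorname{int}\operatorname{dom} f$, and $\|\nabla f(x_k)\|\to+\infty$ for every sequence $(x_k)$ in $\operatorname{int}\operatorname{dom} f$ converging to a point of $\operatorname{bd}\operatorname{dom} f$) and essentially strictly convex ($(\partial f)^{-1}$ is locally bounded on its domain and $f$ is strictly convex on every convex subset of $\operatorname{dom}\partial f$). If $f$ is Legendre then so is $f^*$, and $\nabla f:\operatorname{int}\operatorname{dom} f\to\operatorname{int}\operatorname{dom} f^*$ is a bijection with inverse $\nabla f^*$. For a set $C$, $\nabla f^*(C)$ means $\{\nabla f^*(u):u\in C\cap\operatorname{int}\operatorname{dom} f^*\}$. The Bregman distance is $D_f(x,y)=f(x)-f(y)-\langle\nabla f(y),x-y\rangle$ if $y\in\operatorname{int}\operatorname{dom} f$, and $+\infty$ otherwise. $\overrightarrow{E}_f(\mathcal{S})=\{y\in\operatorname{int}\operatorname{dom} f:\ D_f(p_0,y)=D_f(p_1,y)=\cdots=D_f(p_m,y)\}$, and the set of forward Bregman circumcenters of $\mathcal{S}$ is $\overrightarrow{CC}_f(\mathcal{S})=\operatorname{aff}(\mathcal{S})\cap\overrightarrow{E}_f(\mathcal{S})$. The backward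 Bregman projection of $y\in\operatorname{int}\operatorname{dom} f$ onto $C$ is $\overleftarrow{P}^{f}_{C}(y)=\{u\in C\cap\operatorname{dom} f:\ (\forall c\in C)\ D_f(u,y)\le D_f(c,y)\}$; in (ii) it is a singleton identified with its unique element. *)

theory Defs
  imports "HOL-Analysis.Analysis"
begin

definition eff_dom :: "('a \<Rightarrow> ereal) \<Rightarrow> 'a set" where
  "eff_dom f = {x. f x < \<infinity>}"

definition epi :: "('a \<Rightarrow> ereal) \<Rightarrow> ('a \<times> real) set" where
  "epi f = {(x, r). f x \<le> ereal r}"

definition proper :: "('a \<Rightarrow> ereal) \<Rightarrow> bool" where
  "proper f \<longleftrightarrow> (\<forall>x. f x \<noteq> -\<infinity>) \<and> eff_dom f \<noteq> {}"

(* Convexity and closedness (lower semicontinuity) are those of the epigraph. *)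
definition Gamma0 :: "('a::real_inner \<Rightarrow> ereal) set" where
  "Gamma0 = {f. proper f \<and> convex (epi f) \<and> closed (epi f)}"

definition fenchel_conj :: "('a::real_inner \<Rightarrow> ereal) \<Rightarrow> 'a \<Rightarrow> ereal" where
  "fenchel_conj f u = (SUP x. ereal (u \<bullet> x) - f x)"

(* For proper f this is empty at every x outside eff_dom f. *)
definition subdiff :: "('a::real_inner \<Rightarrow> ereal) \<Rightarrow> 'a \<Rightarrow> 'a set" where
  "subdiff f x = {u. \<forall>z. f x + ereal (u \<bullet> (z - x)) \<le> f z}"

definition subdiff_dom :: "('a::real_inner \<Rightarrow> ereal) \<Rightarrow> 'a set" where
  "subdiff_dom f = {x. subdiff f x \<noteq> {}}"

definition subdiff_inv :: "('a::real_inner \<Rightarrow> ereal) \<Rightarrow> 'a \<Rightarrow> 'a set" where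
  "subdiff_inv f u = {x. u \<in> subdiff f x}"

(* The Gateaux derivative of f at x is the bounded linear functional represented by g.
   The interiority condition makes f finite near x along every line (for proper f), so that
   the convention real_of_ereal \<infinity> = 0 never interferes. *)
definition has_gradient :: "('a::real_inner \<Rightarrow> ereal) \<Rightarrow> 'a \<Rightarrow> 'a \<Rightarrow> bool" where
  "has_gradient f g x \<longleftrightarrow> x \<in> interior (eff_dom f) \<and>
     (\<forall>h. ((\<lambda>t. real_of_ereal (f (x + t *\<^sub>R h))) has_real_derivative (g \<bullet> h)) (at 0))"

definition grad :: "('a::real_inner \<Rightarrow> ereal) \<Rightarrow> 'a \<Rightarrow> 'a" where
  "grad f x = (THE g. has_gradient f g x)"

definition grad_image :: "('a::real_inner \<Rightarrow> ereal) \<Rightarrow> 'a set \<Rightarrow> 'a set" where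
  "grad_image f C = {grad f x | x. x \<in> C \<inter> interior (eff_dom f)}"

definition essentially_smooth :: "('a::real_inner \<Rightarrow> ereal) \<Rightarrow> bool" where
  "essentially_smooth f \<longleftrightarrow>
     subdiff_dom f = interior (eff_dom f) \<and> interior (eff_dom f) \<noteq> {} \<and>
     (\<forall>x \<in> interior (eff_dom f). \<exists>g. has_gradient f g x) \<and>
     (\<forall>s z. (\<forall>k::nat. s k \<in> interior (eff_dom f)) \<and> s \<longlonglongrightarrow> z \<and> z \<in> frontier (eff_dom f)
        \<longrightarrow> filterlim (\<lambda>k. norm (grad f (s k))) at_top sequentially)"

definition strictly_convex_on :: "'a::real_vector set \<Rightarrow> ('a \<Rightarrow> ereal) \<Rightarrow> bool" where
  "strictly_convex_on C f \<longleftrightarrow>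
     (\<forall>x\<in>C. \<forall>y\<in>C. \<forall>t::real. x \<noteq> y \<and> 0 < t \<and> t < 1 \<longrightarrow>
        f ((1 - t) *\<^sub>R x + t *\<^sub>R y) < ereal (1 - t) * f x + ereal t * f y)"

definition essentially_strictly_convex :: "('a::real_inner \<Rightarrow> ereal) \<Rightarrow> bool" where
  "essentially_strictly_convex f \<longleftrightarrow>
     (\<forall>u. subdiff_inv f u \<noteq> {} \<longrightarrow> (\<exists>e>0. bounded (\<Union>v \<in> ball u e. subdiff_inv f v))) \<and>
     (\<forall>C. convex C \<and> C \<subseteq> subdiff_dom f \<longrightarrow> strictly_convex_on C f)"

definition legendre :: "('a::real_inner \<Rightarrow> ereal) \<Rightarrow> bool" where
  "legendre f \<longleftrightarrow> essentially_smooth f \<and> essentially_strictly_convex f"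

definition bregman :: "('a::real_inner \<Rightarrow> ereal) \<Rightarrow> 'a \<Rightarrow> 'a \<Rightarrow> ereal" where
  "bregman f x y =
     (if y \<in> interior (eff_dom f) then f x - f y - ereal (grad f y \<bullet> (x - y)) else \<infinity>)"

definition fwd_equidist :: "('a::real_inner \<Rightarrow> ereal) \<Rightarrow> 'a set \<Rightarrow> 'a set" where
  "fwd_equidist f S =
     {y \<in> interior (eff_dom f). \<forall>p\<in>S. \<forall>q\<in>S. bregman f p y = bregman f q y}"

definition fwd_circumcenters :: "('a::real_inner \<Rightarrow> ereal) \<Rightarrow> 'a set \<Rightarrow> 'a set" where
  "fwd_circumcenters f S = affine hull S \<inter> fwd_equidist f S"

definition bwd_proj :: "('a::real_inner \<Rightarrow> ereal) \<Rightarrow> 'a set \<Rightarrow> 'a \<Rightarrow> 'a set" where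
  "bwd_proj f C y = {u \<in> C \<inter> eff_dom f. \<forall>c\<in>C. bregman f u y \<le> bregman f c y}"

end

theory Submission
  imports Defs
begin

text \<open>
  For \<open>x\<close> in the interior of the domain, the terms \<open>f(x)\<close> cancel in \<open>D_f(p_i, x) = D_f(p_0, x)\<close>, so
  equidistance says that \<open>\<nabla>f(x)\<close> has prescribed inner products with all \<open>p_i - p_0\<close>; comparing with
  \<open>y\<close> puts \<open>\<nabla>f(x) - \<nabla>f(y)\<close> in \<open>M\<^sup>\<bottom>\<close>. It remains to invert \<open>\<nabla>f\<close>. Local boundedness of the inverse
  subdifferential makes \<open>f\<^sup>*\<close> bounded above near \<open>\<nabla>f(x)\<close>, hence \<open>f - \<nabla>f(x)\<close> coercive, and in a
  Hilbert space coercive closed convex functions attain their minima on closed convex sets. Applied on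
  half-spaces that avoid \<open>x\<close>, this shows that almost minimisers of \<open>f - \<nabla>f(x)\<close> are weakly close to
  \<open>x\<close>, which is the Gateaux differentiability of \<open>f\<^sup>*\<close> at \<open>\<nabla>f(x)\<close> with gradient \<open>x\<close>.

  The backward projection minimises \<open>f - \<nabla>f(y)\<close> on \<open>aff S\<close>. Coercivity gives existence, the gradient
  blow-up at the boundary forces minimisers into the interior, and there strict convexity gives
  uniqueness and stationarity along \<open>p_i - p_0\<close> gives equidistance.
\<close>

subsection \<open>Convexity in Hilbert spaces\<close>

text \<open>Stands in for weak compactness. Points \<open>x n\<close> of almost minimal norm in
  \<open>C n\<close> form a Cauchy sequence by the parallelogram law, since midpoints stay in the
  convex set and so have norm at least \<open>d n\<close>.\<close>

lemma nested_closed_convex_Inter_nonempty: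
  fixes C :: "nat \<Rightarrow> 'a::{real_inner, complete_space} set"
  assumes closed: "\<And>n. closed (C n)" and convex: "\<And>n. convex (C n)"
    and ne: "\<And>n. C n \<noteq> {}" and bounded: "bounded (C 0)" and dec: "decseq C"
  shows "(\<Inter>n. C n) \<noteq> {}"
proof -
  define d where "d n = (INF x\<in>C n. norm x)" for n
  have bdd: "bdd_below (norm ` C n)" for n
    by (rule bdd_belowI[of _ 0]) auto
  have d_le: "d n \<le> norm x" if "x \<in> C n" for n x
    unfolding d_def using bdd that by (rule cINF_lower)
  have sub: "C n \<subseteq> C k" if "k \<le> n" for n k
    using dec that by (auto simp: decseq_def)
  have d_nonneg: "0 \<le> d n" for n
    unfolding d_def using ne by (intro cINF_greatest) auto
  have incd: "incseq d"
    unfolding incseq_def d_def using sub bdd ne by (auto intro!: cINF_superset_mono)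
  have "\<exists>x\<in>C n. norm x < d n + 1 / Suc n" for n
    using cINF_less_iff[OF ne bdd, of n "d n + 1 / Suc n"] by (simp add: d_def)
  then obtain x where x: "\<And>n. x n \<in> C n" "\<And>n. norm (x n) < d n + 1 / Suc n"
    by metis
  obtain B where B: "\<And>x. x \<in> C 0 \<Longrightarrow> norm x \<le> B"
    using bounded by (auto simp: bounded_iff)
  have "d n \<le> B" for n
    using d_le[OF x(1), of n] B sub[of 0 n] x(1)[of n] by fastforce
  then have "convergent d"
    using incd by (intro Bseq_monoseq_convergent)
      (auto simp: monoseq_iff d_nonneg intro!: BseqI'[of _ B])
  then obtain L where L: "d \<longlonglongrightarrow> L" by (auto simp: convergent_def)
  have dL: "d n \<le> L" for n using incd L by (rule incseq_le)
  \<comment> \<open>For \<open>n \<le> k\<close> both points have norm at most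
    \<open>L + 1 / Suc n\<close> and their midpoint has norm at least \<open>d n\<close>; the
    parallelogram identity turns this into a bound on the squared distance.\<close>
  define e where "e n = 4 * ((L + 1 / Suc n)\<^sup>2 - (d n)\<^sup>2)" for n
  have "e \<longlonglongrightarrow> 4 * ((L + 0)\<^sup>2 - L\<^sup>2)"
    unfolding e_def by (intro tendsto_intros L LIMSEQ_inverse_real_of_nat[unfolded inverse_eq_divide])
  then have e0: "e \<longlonglongrightarrow> 0" by simp
  have parallelogram: "(dist (x n) (x k))\<^sup>2 \<le> e n" if "n \<le> k" for n k
  proof -
    have "(1/2) *\<^sub>R x n + (1/2) *\<^sub>R x k \<in> C n"
      using convex x(1) sub[OF that] by (intro convexD) auto
    then have "d n \<le> norm ((1/2) *\<^sub>R x n + (1/2) *\<^sub>R x k)" by (rule d_le)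
    then have 1: "(d n)\<^sup>2 \<le> (norm ((1/2) *\<^sub>R x n + (1/2) *\<^sub>R x k))\<^sup>2"
      using d_nonneg by (intro power_mono) auto
    have "1 / Suc k \<le> 1 / Suc n" using that by (simp add: frac_le)
    then have "norm (x k) \<le> L + 1 / Suc n" "norm (x n) \<le> L + 1 / Suc n"
      using x(2)[of k] x(2)[of n] dL[of k] dL[of n] by linarith+
    then have 2: "(norm (x k))\<^sup>2 \<le> (L + 1 / Suc n)\<^sup>2" "(norm (x n))\<^sup>2 \<le> (L + 1 / Suc n)\<^sup>2"
      by (auto intro!: power_mono)
    have "(dist (x n) (x k))\<^sup>2 = 2 * (norm (x n))\<^sup>2 + 2 * (norm (x k))\<^sup>2
        - 4 * (norm ((1/2) *\<^sub>R x n + (1/2) *\<^sub>R x k))\<^sup>2"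
      unfolding dist_norm power2_norm_eq_inner
      by (simp add: inner_add_left inner_add_right inner_diff_left inner_diff_right inner_commute)
    then show ?thesis using 1 2 by (simp add: e_def)
  qed
  have "Cauchy x"
  proof (rule metric_CauchyI)
    fix r :: real assume "0 < r"
    then have "\<forall>\<^sub>F n in sequentially. e n < (r/2)\<^sup>2"
      by (intro order_tendstoD(2)[OF e0]) simp
    then obtain N where N: "e N < (r/2)\<^sup>2" by (auto simp: eventually_sequentially)
    have near: "dist (x N) (x k) < r/2" if "N \<le> k" for k
    proof -
      have "(dist (x N) (x k))\<^sup>2 < (r/2)\<^sup>2" using parallelogram[OF that] N by linarith
      then show ?thesis by (rule power_less_imp_less_base) (use \<open>0 < r\<close> in simp)
    qed
    have "dist (x i) (x j) < r" if "N \<le> i" "N \<le> j" for i j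
      using near[OF that(1)] near[OF that(2)] dist_triangle3[of "x i" "x j" "x N"] by linarith
    then show "\<exists>M. \<forall>m\<ge>M. \<forall>n\<ge>M. dist (x m) (x n) < r" by blast
  qed
  then obtain z where z: "x \<longlonglongrightarrow> z" using Cauchy_convergent_iff convergent_def by blast
  have "z \<in> C n" for n
  proof (rule Lim_in_closed_set[OF closed _ _ z])
    show "\<forall>\<^sub>F k in sequentially. x k \<in> C n"
      using x(1) sub by (auto simp: eventually_sequentially intro!: exI[of _ n])
  qed simp
  then show ?thesis by blast
qed

text \<open>An orthogonal spanning family gives an explicit continuous projection \<open>P\<close>,
  and the span is its set of fixed points. The ambient space may be infinite-dimensional.\<close>

lemma closed_span_finite:
  fixes B :: "'a::real_inner set"
  assumes "finite B"
  shows "closed (span B)"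
proof -
  obtain C where C: "finite C" "span C = span B" "pairwise orthogonal C"
    using basis_orthogonal[OF assms] by blast
  \<comment> \<open>\<open>C\<close> may contain the zero vector, where
    \<open>inverse 0 = 0\<close>; the diagonal case of the sum below still holds there because both
    sides vanish.\<close>
  define k :: "'a \<Rightarrow> real" where "k b = inverse (b \<bullet> b)" for b
  define P where "P x = (\<Sum>b\<in>C. (k b * (b \<bullet> x)) *\<^sub>R b)" for x
  have P_in: "P x \<in> span C" for x
    unfolding P_def by (intro span_sum span_scale span_base)
  have orth: "(x - P x) \<bullet> c = 0" if "c \<in> C" for x c
  proof -
    have "P x \<bullet> c = (\<Sum>b\<in>C. if b = c then c \<bullet> x else 0)"
      unfolding P_def inner_sum_left using C(3) that
      by (intro sum.cong) (auto simp: pairwise_def orthogonal_def k_def field_simps)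
    then show ?thesis using C(1) that by (simp add: inner_diff_left inner_commute[of c])
  qed
  have "x \<in> span C \<longleftrightarrow> x = P x" for x
  proof
    assume "x \<in> span C"
    then have "x - P x \<in> span C" using P_in by (intro span_diff)
    moreover have "orthogonal (x - P x) c" if "c \<in> C" for c
      using orth[OF that] by (simp add: orthogonal_def)
    ultimately have "orthogonal (x - P x) (x - P x)"
      using orthogonal_to_span by blast
    then show "x = P x" by (simp add: orthogonal_self)
  next
    assume "x = P x" then show "x \<in> span C" using P_in by metis
  qed
  then have "span C = {x. x = P x}" by blast
  moreover have "closed {x. x = P x}"
    unfolding P_def by (intro closed_Collect_eq continuous_intros)
  ultimately show ?thesis using C(2) by simp
qed

lemma closed_affine_hull_finite:
  fixes S :: "'a::real_inner set"
  assumes "finite S"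
  shows "closed (affine hull S)"
proof (cases "S = {}")
  case False
  then obtain a where "a \<in> S" by blast
  then have "affine hull S = (\<lambda>x. a + x) ` span ((\<lambda>x. - a + x) ` S)"
    using affine_hull_insert_span_gen[of a S] by (simp add: insert_absorb)
  then show ?thesis using assms by (auto intro!: closed_translation closed_span_finite)
qed simp

text \<open>The homothety with centre \<open>x\<close> and ratio \<open>t\<close> maps a ball around
  \<open>z\<close> onto a ball around the new point, and convexity keeps the image in
  \<open>D\<close>.\<close>

lemma interior_convex_shrink:
  fixes D :: "'a::real_normed_vector set"
  assumes "convex D" "x \<in> D" "z \<in> interior D" "0 < t" "t \<le> 1"
  shows "x + t *\<^sub>R (z - x) \<in> interior D"
proof -
  obtain r where r: "0 < r" "ball z r \<subseteq> D" using assms(3) by (auto simp: mem_interior)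
  have "ball (x + t *\<^sub>R (z - x)) (t * r) \<subseteq> D"
  proof
    fix w assume w: "w \<in> ball (x + t *\<^sub>R (z - x)) (t * r)"
    define v where "v = z + (1/t) *\<^sub>R (w - (x + t *\<^sub>R (z - x)))"
    have "norm (v - z) = norm (w - (x + t *\<^sub>R (z - x))) / t"
      using assms(4) by (simp add: v_def)
    also have "\<dots> < r" using w assms(4)
      by (simp add: dist_norm norm_minus_commute field_simps)
    finally have "v \<in> D" using r by (auto simp: dist_norm norm_minus_commute)
    moreover have "w = (1 - t) *\<^sub>R x + t *\<^sub>R v"
      using assms(4) by (simp add: v_def algebra_simps)
    ultimately show "w \<in> D" using assms by (simp add: convex_alt)
  qed
  then show ?thesis using r(1) assms(4) mult_pos_pos unfolding mem_interior by blast
qed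

section \<open>Epigraphs, effective domains and sublevel sets\<close>

lemma epi_convexD:
  assumes "convex (epi g)" "g x \<le> ereal a" "g z \<le> ereal b" "0 \<le> t" "t \<le> 1"
  shows "g ((1 - t) *\<^sub>R x + t *\<^sub>R z) \<le> ereal ((1 - t) * a + t * b)"
proof -
  have "(x, a) \<in> epi g" "(z, b) \<in> epi g" using assms by (auto simp: epi_def)
  then have "(1 - t) *\<^sub>R (x, a) + t *\<^sub>R (z, b) \<in> epi g"
    using assms by (intro convexD) auto
  then show ?thesis by (simp add: epi_def)
qed

lemma less_PInfty_le_nat:
  assumes "a < (\<infinity>::ereal)"
  obtains n :: nat where "a \<le> ereal (real n)"
proof -
  obtain r where "a \<le> ereal r" using assms by (cases a) auto
  moreover obtain n :: nat where "r \<le> real n" using real_arch_simple by blast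
  ultimately show ?thesis using that[of n] by (meson ereal_less_eq(3) order_trans)
qed

lemma convex_eff_dom:
  assumes "convex (epi g)"
  shows "convex (eff_dom g)"
  unfolding convex_alt
proof clarsimp
  fix x z and t :: real assume *: "x \<in> eff_dom g" "z \<in> eff_dom g" "0 \<le> t" "t \<le> 1"
  obtain a b :: nat where "g x \<le> ereal a" "g z \<le> ereal b"
    using *(1,2) less_PInfty_le_nat unfolding eff_dom_def by (metis mem_Collect_eq)
  then have "g ((1 - t) *\<^sub>R x + t *\<^sub>R z) \<le> ereal ((1 - t) * a + t * b)"
    using assms * by (intro epi_convexD)
  then show "(1 - t) *\<^sub>R x + t *\<^sub>R z \<in> eff_dom g" by (auto simp: eff_dom_def)
qed

text \<open>Bounding \<open>g\<close> by a function \<open>q\<close> instead of a constant yields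
  the sublevel sets of \<open>g - q\<close> without subtracting extended reals.\<close>

lemma closed_sublevel:
  fixes g :: "'a::real_inner \<Rightarrow> ereal"
  assumes "closed (epi g)" "continuous_on UNIV q"
  shows "closed {z. g z \<le> ereal (q z)}"
proof -
  have "closed ((\<lambda>z. (z, q z)) -` epi g)"
    using assms by (intro closed_vimage continuous_intros)
  then show ?thesis by (simp add: epi_def vimage_def)
qed

lemma convex_sublevel:
  fixes g :: "'a::real_inner \<Rightarrow> ereal"
  assumes g: "convex (epi g)" and q: "concave_on UNIV q"
  shows "convex {z. g z \<le> ereal (q z)}"
  unfolding convex_alt
proof clarsimp
  fix x z and t :: real
  assume *: "g x \<le> ereal (q x)" "g z \<le> ereal (q z)" "0 \<le> t" "t \<le> 1"
  have "g ((1 - t) *\<^sub>R x + t *\<^sub>R z) \<le> ereal ((1 - t) * q x + t * q z)"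
    using g * by (intro epi_convexD)
  also have "\<dots> \<le> ereal (q ((1 - t) *\<^sub>R x + t *\<^sub>R z))"
    using concave_onD[OF q *(3,4), of x z] by simp
  finally show "g ((1 - t) *\<^sub>R x + t *\<^sub>R z) \<le> ereal (q ((1 - t) *\<^sub>R x + t *\<^sub>R z))" .
qed

text \<open>Baire's theorem puts a ball inside one of the closed sublevel sets, and convexity
  transports the bound to a neighbourhood of \<open>x\<close>. This serves both \<open>f\<close> and
  its conjugate.\<close>

lemma locally_bounded_above:
  fixes g :: "'a::{real_inner, complete_space} \<Rightarrow> ereal"
  assumes conv: "convex (epi g)" and cl: "closed (epi g)" and x: "x \<in> interior (eff_dom g)"
  obtains r K where "0 < r" "\<And>z. z \<in> ball x r \<Longrightarrow> g z \<le> ereal K"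
proof -
  define A where "A n = {z. g z \<le> ereal (real n)}" for n
  have A: "closed (A n)" for n
    unfolding A_def by (rule closed_sublevel[OF cl]) simp
  have "eff_dom g \<subseteq> (\<Union>n. A n)"
    using less_PInfty_le_nat unfolding eff_dom_def A_def by blast
  then have "interior (\<Union>n. A n) \<noteq> {}" using x interior_mono by blast
  moreover have "interior (\<Union>n. A n) = {}" if "\<And>n. interior (A n) = {}"
    using Met_TC.metric_Baire_category_alt[where 'a='a, of "range A"] A that
    by (auto simp: complete_UNIV)
  ultimately obtain N where "interior (A N) \<noteq> {}" by blast
  then obtain w s where s: "0 < s" "ball w s \<subseteq> A N" by (auto simp: mem_interior)
  obtain e where e: "0 < e" "ball x e \<subseteq> eff_dom g" using x by (auto simp: mem_interior)
  \<comment> \<open>Small enough that \<open>x + d *\<^sub>R (x - w)\<close>, the point beyond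
    \<open>x\<close> as seen from \<open>w\<close>, stays in the ball around \<open>x\<close>; the
    \<open>+ 1\<close> avoids a zero denominator.\<close>
  define d where "d = e / (2 * (norm (x - w) + 1))"
  have "norm (x - w) + 1 > 0" by (smt (verit) norm_ge_zero)
  then have d: "0 < d" using e by (simp add: d_def)
  have "d * norm (x - w) < e"
    using e norm_ge_zero[of "x - w"] by (simp add: d_def field_simps add_pos_nonneg)
  then have "x + d *\<^sub>R (x - w) \<in> eff_dom g"
    using e d by (auto simp: dist_norm)
  then obtain k :: nat where k: "g (x + d *\<^sub>R (x - w)) \<le> ereal k"
    using less_PInfty_le_nat unfolding eff_dom_def by blast
  \<comment> \<open>With this weight \<open>x\<close> is a convex combination of the point beyond it
    and \<open>w\<close>, so the ball around \<open>w\<close> shrinks by the factor \<open>t\<close>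
    to one around \<open>x\<close>.\<close>
  define t where "t = d / (1 + d)"
  have t: "0 < t" "t < 1" "1 - t = 1 / (1 + d)" using d by (auto simp: t_def field_simps)
  have "g z \<le> ereal ((1 - t) * k + t * N)" if z: "z \<in> ball x (t * s)" for z
  proof -
    define v where "v = w + (1/t) *\<^sub>R (z - x)"
    have "norm (v - w) = norm (z - x) / t" using t by (simp add: v_def)
    also have "\<dots> < s"
      using z t by (simp add: dist_norm norm_minus_commute field_simps)
    finally have "norm (v - w) < s" .
    then have "g v \<le> ereal N" using s by (auto simp: A_def dist_norm norm_minus_commute subset_iff)
    then have "g ((1 - t) *\<^sub>R (x + d *\<^sub>R (x - w)) + t *\<^sub>R v) \<le> ereal ((1 - t) * k + t * N)"
      using k t conv by (intro epi_convexD) auto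
    moreover have "(1 - t) *\<^sub>R (x + d *\<^sub>R (x - w)) + t *\<^sub>R v
        = ((1 - t) * (1 + d)) *\<^sub>R x + (t - (1 - t) * d) *\<^sub>R w + (z - x)"
      using t by (simp add: v_def algebra_simps)
    moreover have "(1 - t) * (1 + d) = 1" "t - (1 - t) * d = 0"
      unfolding t(3) using d by (auto simp: t_def)
    ultimately show ?thesis by simp
  qed
  then show ?thesis using that[of "t * s"] t s mult_pos_pos by blast
qed

subsection \<open>Closed convex functions and their conjugates\<close>

locale closed_convex_function =
  fixes f :: "'a::{real_inner, complete_space} \<Rightarrow> ereal"
  assumes Gamma0: "f \<in> Gamma0"
begin

abbreviation D :: "'a set" where "D \<equiv> eff_dom f"

text \<open>Outside \<open>D\<close> this has the default value \<open>0\<close>, so inequalities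
  for \<open>F\<close> are confined to points of \<open>D\<close>.\<close>

definition F :: "'a \<Rightarrow> real" where "F x = real_of_ereal (f x)"

lemma epi_convex: "convex (epi f)" and epi_closed: "closed (epi f)"
  and not_MInf: "f x \<noteq> -\<infinity>" and D_nonempty: "D \<noteq> {}"
  using Gamma0 by (auto simp: Gamma0_def proper_def)

lemma f_eq_F: "x \<in> D \<Longrightarrow> f x = ereal (F x)"
  using not_MInf[of x] by (cases "f x") (auto simp: F_def eff_dom_def)

lemma f_eq_PInf: "x \<notin> D \<Longrightarrow> f x = \<infinity>"
  by (simp add: eff_dom_def)

lemma f_le_iff: "f x \<le> ereal c \<longleftrightarrow> x \<in> D \<and> F x \<le> c"
  by (cases "x \<in> D") (auto simp: f_eq_F f_eq_PInf)

lemma convex_D: "convex D"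
  using epi_convex by (rule convex_eff_dom)

lemma F_convex:
  assumes "x \<in> D" "z \<in> D" "0 \<le> t" "t \<le> 1"
  shows "F ((1 - t) *\<^sub>R x + t *\<^sub>R z) \<le> (1 - t) * F x + t * F z"
  using epi_convexD[OF epi_convex, of x "F x" z "F z" t] assms by (simp add: f_le_iff)

section \<open>Subgradients and the conjugate\<close>

lemma subdiff_iff:
  "u \<in> subdiff f x \<longleftrightarrow> x \<in> D \<and> (\<forall>z\<in>D. F x + u \<bullet> (z - x) \<le> F z)"
proof (cases "x \<in> D")
  case True
  have "f x + ereal (u \<bullet> (z - x)) \<le> f z \<longleftrightarrow> (z \<in> D \<longrightarrow> F x + u \<bullet> (z - x) \<le> F z)" for z
    using True by (cases "z \<in> D") (auto simp: f_eq_F f_eq_PInf)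
  then show ?thesis using True by (auto simp: subdiff_def)
next
  case False
  obtain z where "z \<in> D" using D_nonempty by blast
  then have "\<not> f x + ereal (u \<bullet> (z - x)) \<le> f z" using False by (simp add: f_eq_PInf f_eq_F)
  then show ?thesis using False by (auto simp: subdiff_def)
qed

text \<open>Fermat's rule for \<open>F\<close> tilted by \<open>u\<close>: inverting the
  subdifferential becomes a minimisation problem.\<close>

lemma subdiff_iff_minimizer:
  "u \<in> subdiff f x \<longleftrightarrow> x \<in> D \<and> (\<forall>z\<in>D. F x - u \<bullet> x \<le> F z - u \<bullet> z)"
proof -
  have "F x + u \<bullet> (z - x) \<le> F z \<longleftrightarrow> F x - u \<bullet> x \<le> F z - u \<bullet> z" for z
    unfolding inner_diff_right by linarith
  then show ?thesis by (simp add: subdiff_iff)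
qed

lemma conj_le_iff: "fenchel_conj f u \<le> ereal K \<longleftrightarrow> (\<forall>z\<in>D. u \<bullet> z - F z \<le> K)"
proof -
  have "ereal (u \<bullet> z) - f z \<le> ereal K \<longleftrightarrow> (z \<in> D \<longrightarrow> u \<bullet> z - F z \<le> K)" for z
    by (cases "z \<in> D") (auto simp: f_eq_F f_eq_PInf)
  then show ?thesis by (auto simp: fenchel_conj_def SUP_le_iff)
qed

lemma conj_ge: "z \<in> D \<Longrightarrow> ereal (u \<bullet> z - F z) \<le> fenchel_conj f u"
  unfolding fenchel_conj_def by (rule SUP_upper2[of z]) (simp_all add: f_eq_F)

lemma conj_eq:
  assumes "u \<in> subdiff f x"
  shows "fenchel_conj f u = ereal (u \<bullet> x - F x)"
  using assms by (intro antisym conj_ge)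
    (auto simp: conj_le_iff subdiff_iff_minimizer algebra_simps)

lemma epi_conj: "epi (fenchel_conj f) = (\<Inter>z\<in>D. {(u, r). u \<bullet> z - F z \<le> r})"
  by (auto simp: epi_def conj_le_iff)

lemma convex_epi_conj: "convex (epi (fenchel_conj f))"
  unfolding epi_conj
proof (intro convex_INT)
  fix z
  have *: "{(u, r). u \<bullet> z - F z \<le> r} = {w. (z, -1) \<bullet> w \<le> F z}"
    by (auto simp: inner_commute)
  show "convex {(u, r). u \<bullet> z - F z \<le> r}"
    unfolding * by (rule convex_halfspace_le)
qed

lemma closed_epi_conj: "closed (epi (fenchel_conj f))"
  unfolding epi_conj
proof (intro closed_INT ballI)
  fix z
  have *: "{(u, r). u \<bullet> z - F z \<le> r} = {w. (z, -1) \<bullet> w \<le> F z}"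
    by (auto simp: inner_commute)
  show "closed {(u, r). u \<bullet> z - F z \<le> r}"
    unfolding * by (rule closed_halfspace_le)
qed

section \<open>Existence of minimisers and of points with prescribed subgradients\<close>

lemma attains_minimum:
  assumes q: "continuous_on UNIV q" "concave_on UNIV q"
    and C: "closed C" "convex C" "C \<inter> D \<noteq> {}"
    and bounded: "\<And>c. bounded {z \<in> C \<inter> D. F z - q z \<le> c}"
    and below: "\<And>z. z \<in> C \<inter> D \<Longrightarrow> b \<le> F z - q z"
  obtains z where "z \<in> C \<inter> D" "\<And>w. w \<in> C \<inter> D \<Longrightarrow> F z - q z \<le> F w - q w"
proof -
  define I where "I = (INF z\<in>C \<inter> D. F z - q z)"
  have bdd: "bdd_below ((\<lambda>z. F z - q z) ` (C \<inter> D))"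
    using below by (intro bdd_belowI[of _ b]) blast
  \<comment> \<open>A common point of these nested slices minimises \<open>F - q\<close> over
    \<open>C \<inter> D\<close>. Concavity of \<open>q\<close> makes the slices convex;
    \<open>q\<close> will be linear or, for proximal points, quadratic.\<close>
  define A where "A n = C \<inter> {z. f z \<le> ereal (q z + (I + 1 / Suc n))}" for n
  have A_eq: "A n = {z \<in> C \<inter> D. F z - q z \<le> I + 1 / Suc n}" for n
    by (auto simp: A_def f_le_iff algebra_simps)
  have "(\<Inter>n. A n) \<noteq> {}"
  proof (rule nested_closed_convex_Inter_nonempty)
    fix n
    show "closed (A n)"
      unfolding A_def by (intro closed_Int C closed_sublevel epi_closed continuous_intros q)
    have "concave_on UNIV (\<lambda>z. q z + (I + 1 / Suc n))"
      by (rule concave_on_add[OF q(2)]) (simp add: concave_on_const)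
    then show "convex (A n)"
      unfolding A_def by (intro convex_Int C convex_sublevel epi_convex)
    show "A n \<noteq> {}"
      using cINF_less_iff[OF C(3) bdd, of "I + 1 / Suc n"]
      by (fastforce simp: A_eq I_def)
  next
    show "bounded (A 0)" unfolding A_eq by (rule bounded)
    have "1 / real (Suc n) \<le> 1 / real (Suc k)" if "k \<le> n" for k n
      using that by (simp add: frac_le)
    then show "decseq A" unfolding decseq_def A_eq by fastforce
  qed
  then obtain z where z: "\<And>n. z \<in> A n" by blast
  have "F z - q z \<le> I + 0"
    by (rule LIMSEQ_le_const[OF tendsto_add[OF tendsto_const LIMSEQ_inverse_real_of_nat]])
      (use z in \<open>auto simp: A_eq inverse_eq_divide\<close>)
  moreover have "I \<le> F w - q w" if "w \<in> C \<inter> D" for w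
    unfolding I_def using bdd that by (rule cINF_lower)
  ultimately show thesis using z[of 0] by (intro that[of z]) (force simp: A_eq)+
qed

lemma coercive:
  assumes bound: "\<And>v. v \<in> ball u r \<Longrightarrow> fenchel_conj f v \<le> ereal K" and r: "0 < r"
  obtains s where "0 < s" "\<And>z. z \<in> D \<Longrightarrow> s * norm z \<le> F z - u \<bullet> z + K"
proof (rule that[of "r/2"])
  show "0 < r/2" using r by simp
  fix z assume z: "z \<in> D"
  \<comment> \<open>Half the radius in the direction of \<open>z\<close> stays in the open ball and
    gains \<open>r / 2 * norm z\<close> in the inner product; \<open>sgn 0 = 0\<close> covers
    \<open>z = 0\<close>.\<close>
  define v where "v = u + (r / 2) *\<^sub>R sgn z"
  have "v \<in> ball u r" using r by (simp add: v_def dist_norm norm_sgn)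
  then have "v \<bullet> z - F z \<le> K" using bound z by (simp add: conj_le_iff)
  moreover have "v \<bullet> z = u \<bullet> z + r / 2 * norm z"
    by (cases "z = 0") (simp_all add: v_def inner_add_left sgn_div_norm
        dot_square_norm power2_eq_square)
  ultimately show "r / 2 * norm z \<le> F z - u \<bullet> z + K" by simp
qed

lemma coercive_attains_minimum:
  assumes bound: "\<And>v. v \<in> ball u r \<Longrightarrow> fenchel_conj f v \<le> ereal K" and r: "0 < r"
    and C: "closed C" "convex C" "C \<inter> D \<noteq> {}"
  obtains z where "z \<in> C \<inter> D" "\<And>w. w \<in> C \<inter> D \<Longrightarrow> F z - u \<bullet> z \<le> F w - u \<bullet> w"
proof -
  obtain s where s: "0 < s" "\<And>z. z \<in> D \<Longrightarrow> s * norm z \<le> F z - u \<bullet> z + K"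
    using coercive[OF bound r] by metis
  show thesis
  proof (rule attains_minimum[where q = "\<lambda>z. u \<bullet> z" and C = C and b = "- K"])
    show "continuous_on UNIV (\<lambda>z. u \<bullet> z)" by (intro continuous_intros)
    show "concave_on UNIV (\<lambda>z. u \<bullet> z)"
      by (simp add: concave_on_iff inner_add_right)
    show "bounded {z \<in> C \<inter> D. F z - u \<bullet> z \<le> c}" for c
    proof (rule boundedI)
      fix z assume "z \<in> {z \<in> C \<inter> D. F z - u \<bullet> z \<le> c}"
      then have "s * norm z \<le> c + K" using s(2)[of z] by auto
      then show "norm z \<le> (c + K) / s" using s(1) by (simp add: field_simps)
    qed
    show "- K \<le> F z - u \<bullet> z" if "z \<in> C \<inter> D" for z
    proof -
      have "0 \<le> s * norm z" using s(1) by simp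
      also have "\<dots> \<le> F z - u \<bullet> z + K" using s(2) that by blast
      finally show ?thesis by simp
    qed
  qed (use C that in auto)
qed

text \<open>The conjugate is bounded above near \<open>u\<close>, so \<open>f\<close> tilted by
  \<open>u\<close> is coercive and has a minimiser over the whole space.\<close>

lemma subdiff_inv_nonempty:
  assumes "u \<in> interior (eff_dom (fenchel_conj f))"
  obtains x where "u \<in> subdiff f x"
proof -
  obtain r K where rK: "0 < r" "\<And>v. v \<in> ball u r \<Longrightarrow> fenchel_conj f v \<le> ereal K"
    using locally_bounded_above[OF convex_epi_conj closed_epi_conj assms] by metis
  obtain z where z: "z \<in> UNIV \<inter> D" "\<And>w. w \<in> UNIV \<inter> D \<Longrightarrow> F z - u \<bullet> z \<le> F w - u \<bullet> w"
    using coercive_attains_minimum[where C = UNIV, OF rK(2) rK(1)] D_nonempty by auto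
  then have "u \<in> subdiff f z"
    by (auto simp: subdiff_iff_minimizer)
  then show thesis by (rule that)
qed

lemma subdiff_monotone:
  assumes "u \<in> subdiff f x" "v \<in> subdiff f z"
  shows "0 \<le> (v - u) \<bullet> (z - x)"
proof -
  have "F x + u \<bullet> (z - x) \<le> F z" "F z + v \<bullet> (x - z) \<le> F x"
    using assms by (auto simp: subdiff_iff)
  then show ?thesis by (simp add: inner_diff_left inner_diff_right)
qed

text \<open>\<open>z\<close> minimises \<open>F\<close> tilted by \<open>v\<close> plus
  \<open>e / 2\<close> times the squared distance to \<open>x\<close>. The affine minorant from
  \<open>u\<close> ensures that the quadratic term forces bounded sublevel sets.\<close>

lemma proximal_point:
  assumes u: "u \<in> subdiff f x" and e: "0 < e"
  obtains z where "v - e *\<^sub>R (z - x) \<in> subdiff f z"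
proof -
  define q where "q z = v \<bullet> z - e / 2 * (norm (z - x))\<^sup>2" for z
  have D: "x \<in> D" and sub: "\<And>z. z \<in> D \<Longrightarrow> F x + u \<bullet> (z - x) \<le> F z"
    using u by (auto simp: subdiff_iff)
  have sq: "(norm ((1 - t) *\<^sub>R a + t *\<^sub>R b - x))\<^sup>2
      = (1 - t) * (norm (a - x))\<^sup>2 + t * (norm (b - x))\<^sup>2 - t * (1 - t) * (norm (a - b))\<^sup>2" for a b t
    unfolding power2_norm_eq_inner
    by (simp add: inner_add_left inner_add_right inner_diff_left inner_diff_right inner_commute algebra_simps)
  \<comment> \<open>Half of the quadratic term absorbs \<open>(v - u) \<bullet> (z - x)\<close>
    through Young's inequality; the other half controls \<open>norm (z - x)\<close>.\<close>
  have lower: "F x - v \<bullet> x + (e/4 * (norm (z - x))\<^sup>2 - (norm (v - u))\<^sup>2 / e) \<le> F z - q z"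
    if "z \<in> D" for z
  proof -
    have "0 \<le> e * (norm (z - x) / 2 - norm (v - u) / e)\<^sup>2" using e by simp
    also have "\<dots> = e/4 * (norm (z - x))\<^sup>2 + (norm (v - u))\<^sup>2 / e - norm (v - u) * norm (z - x)"
      using e by (simp add: power2_eq_square field_simps)
    finally have "norm (v - u) * norm (z - x) \<le> e/4 * (norm (z - x))\<^sup>2 + (norm (v - u))\<^sup>2 / e" by simp
    moreover have "(v - u) \<bullet> (z - x) \<le> norm (v - u) * norm (z - x)" by (rule norm_cauchy_schwarz)
    ultimately show ?thesis using sub[OF that]
      by (simp add: q_def inner_diff_left inner_diff_right)
  qed
  obtain z where z: "z \<in> UNIV \<inter> D" "\<And>w. w \<in> UNIV \<inter> D \<Longrightarrow> F z - q z \<le> F w - q w"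
  proof (rule attains_minimum[where q = q and C = UNIV and b = "F x - v \<bullet> x - (norm (v - u))\<^sup>2 / e"])
    show "continuous_on UNIV q" unfolding q_def by (intro continuous_intros)
    show "concave_on UNIV q"
      unfolding concave_on_def
    proof (rule convex_onI)
      fix t and a b :: 'a assume "(0::real) < t" "t < 1"
      then have "0 \<le> e / 2 * (t * (1 - t) * (norm (a - b))\<^sup>2)" using e by simp
      moreover have "v \<bullet> ((1 - t) *\<^sub>R a + t *\<^sub>R b) = (1 - t) * (v \<bullet> a) + t * (v \<bullet> b)"
        by (simp add: inner_add_right)
      ultimately show "- q ((1 - t) *\<^sub>R a + t *\<^sub>R b) \<le> (1 - t) * - q a + t * - q b"
        unfolding q_def sq by (simp add: field_simps)
    qed simp
    show "bounded {z \<in> UNIV \<inter> D. F z - q z \<le> c}" for c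
    proof -
      define k where "k = \<bar>(c - F x + v \<bullet> x + (norm (v - u))\<^sup>2 / e) * 4 / e\<bar>"
      have "dist x z \<le> sqrt k" if "z \<in> D" "F z - q z \<le> c" for z
      proof (rule real_le_rsqrt)
        have "e * (dist x z)\<^sup>2 \<le> (c - F x + v \<bullet> x + (norm (v - u))\<^sup>2 / e) * 4"
          using lower[OF that(1)] that(2) by (simp add: dist_norm norm_minus_commute)
        then have "(dist x z)\<^sup>2 \<le> (c - F x + v \<bullet> x + (norm (v - u))\<^sup>2 / e) * 4 / e"
          using e by (simp add: pos_le_divide_eq mult.commute)
        then show "(dist x z)\<^sup>2 \<le> k" unfolding k_def by linarith
      qed
      then show ?thesis unfolding bounded_def by blast
    qed
    show "F x - v \<bullet> x - (norm (v - u))\<^sup>2 / e \<le> F z - q z" if "z \<in> UNIV \<inter> D" for z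
    proof -
      have "0 \<le> e/4 * (norm (z - x))\<^sup>2" using e by simp
      then show ?thesis using lower[of z] that by simp
    qed
  qed (use D in auto)
  have "F z + (v - e *\<^sub>R (z - x)) \<bullet> (w - z) \<le> F w" if w: "w \<in> D" for w
  proof -
    define c where "c = F z + (v - e *\<^sub>R (z - x)) \<bullet> (w - z) - F w"
    \<comment> \<open>Compares \<open>z\<close> with a point moved slightly towards
      \<open>w\<close>; after division by \<open>t\<close> the quadratic remainder is of order
      \<open>t\<close> and vanishes in the limit.\<close>
    have small: "c \<le> t * (e / 2 * (norm (w - z))\<^sup>2)" if t: "0 < t" "t < 1" for t
    proof -
      define w' where "w' = (1 - t) *\<^sub>R z + t *\<^sub>R w"
      have "w' \<in> D" using convex_D z(1) w t by (simp add: w'_def convex_alt)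
      then have "F z - q z \<le> F w' - q w'" using z(2) by blast
      also have "F w' \<le> (1 - t) * F z + t * F w"
        unfolding w'_def using F_convex z(1) w t by simp
      also have "q w' = q z + t * ((v - e *\<^sub>R (z - x)) \<bullet> (w - z)) - t * (t * (e / 2 * (norm (w - z))\<^sup>2))"
        unfolding q_def w'_def power2_norm_eq_inner
        by (simp add: inner_add_left inner_add_right inner_diff_left inner_diff_right inner_commute algebra_simps)
      finally have "t * c \<le> t * (t * (e / 2 * (norm (w - z))\<^sup>2))"
        by (simp add: c_def algebra_simps)
      then show ?thesis using t by simp
    qed
    have "((\<lambda>t. t * (e / 2 * (norm (w - z))\<^sup>2)) \<longlongrightarrow> 0 * (e / 2 * (norm (w - z))\<^sup>2)) (at_right 0)"
      by (intro tendsto_intros)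
    then have "c \<le> 0 * (e / 2 * (norm (w - z))\<^sup>2)"
    proof (rule tendsto_lowerbound)
      show "\<forall>\<^sub>F t in at_right 0. c \<le> t * (e / 2 * (norm (w - z))\<^sup>2)"
        using small by (auto simp: eventually_at_right_field intro!: exI[of _ 1])
    qed simp
    then show ?thesis by (simp add: c_def)
  qed
  then have "v - e *\<^sub>R (z - x) \<in> subdiff f z" using z(1) by (auto simp: subdiff_iff)
  then show thesis by (rule that)
qed

text \<open>The proximal points of \<open>v\<close> stay bounded as the regularisation parameter tends to zero,
  so the affine minorants that they provide pass to the limit.\<close>
lemma conj_locally_bounded:
  assumes u: "u \<in> subdiff f x" and e: "0 < e" and bdd: "bounded (\<Union>v\<in>ball u e. subdiff_inv f v)"
  obtains r K where "0 < r" "\<And>v. v \<in> ball u r \<Longrightarrow> fenchel_conj f v \<le> ereal K"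
proof -
  have D: "x \<in> D" and sub: "\<And>z. z \<in> D \<Longrightarrow> F x + u \<bullet> (z - x) \<le> F z"
    using u by (auto simp: subdiff_iff)
  obtain B where B: "\<And>z v. v \<in> ball u e \<Longrightarrow> v \<in> subdiff f z \<Longrightarrow> norm z \<le> B"
    using bdd unfolding bounded_iff subdiff_inv_def by blast
  \<comment> \<open>The limit of the estimate below: \<open>e * B\<close> dominates
    \<open>(v - u) \<bullet> z\<close>, and the remaining error carries a factor
    \<open>t\<close>.\<close>
  define K where "K = u \<bullet> x - F x + e * B"
  \<comment> \<open>Half the radius, because the shift \<open>t *\<^sub>R (z - x)\<close> is by
    monotonicity no longer than \<open>norm (v - u)\<close>, so the shifted subgradient stays within
    \<open>e\<close> of \<open>u\<close>.\<close>
  have "v \<bullet> w - F w \<le> K" if v: "v \<in> ball u (e/2)" and w: "w \<in> D" for v w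
  proof -
    have small: "v \<bullet> w - F w - K \<le> t * ((B + norm x) * (B + norm w))" if t: "0 < t" for t
    proof -
      obtain z where z: "v - t *\<^sub>R (z - x) \<in> subdiff f z"
        using proximal_point[OF u t] by blast
      have "0 \<le> (v - t *\<^sub>R (z - x) - u) \<bullet> (z - x)" using u z by (rule subdiff_monotone)
      then have "t * (norm (z - x))\<^sup>2 \<le> (v - u) \<bullet> (z - x)"
        by (simp add: power2_norm_eq_inner inner_diff_left)
      also have "\<dots> \<le> norm (v - u) * norm (z - x)" by (rule norm_cauchy_schwarz)
      finally have "t * norm (z - x) * norm (z - x) \<le> norm (v - u) * norm (z - x)"
        by (simp add: power2_eq_square mult.assoc)
      then have tz: "t * norm (z - x) \<le> norm (v - u)"
        by (cases "z = x") auto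
      have "norm (u - (v - t *\<^sub>R (z - x))) \<le> norm (u - v) + norm (t *\<^sub>R (z - x))"
        using norm_triangle_ineq[of "u - v" "t *\<^sub>R (z - x)"] by (simp only: diff_diff_eq2 diff_add_eq)
      also have "\<dots> < e" using tz v t by (simp add: dist_norm norm_minus_commute)
      finally have zB: "norm z \<le> B" using z by (intro B[OF _ z]) (simp add: dist_norm)
      have "F z + (v - t *\<^sub>R (z - x)) \<bullet> (w - z) \<le> F w" "F x + u \<bullet> (z - x) \<le> F z"
        using z w sub by (auto simp: subdiff_iff)
      then have "v \<bullet> w - F w \<le> u \<bullet> x - F x + (v - u) \<bullet> z + t * ((z - x) \<bullet> (w - z))"
        by (simp add: inner_diff_left inner_diff_right algebra_simps)
      also have "(v - u) \<bullet> z \<le> norm (v - u) * norm z" by (rule norm_cauchy_schwarz)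
      also have "\<dots> \<le> e * B"
        using v zB e by (intro mult_mono) (auto simp: dist_norm norm_minus_commute)
      also have "(z - x) \<bullet> (w - z) \<le> norm (z - x) * norm (w - z)" by (rule norm_cauchy_schwarz)
      also have "\<dots> \<le> (B + norm x) * (B + norm w)"
        using zB norm_triangle_ineq4[of z x] norm_triangle_ineq4[of w z]
          order_trans[OF norm_ge_zero zB] by (intro mult_mono) auto
      finally show ?thesis using t by (simp add: K_def)
    qed
    have "((\<lambda>t. t * ((B + norm x) * (B + norm w))) \<longlongrightarrow> 0 * ((B + norm x) * (B + norm w))) (at_right 0)"
      by (intro tendsto_intros)
    then have "v \<bullet> w - F w - K \<le> 0 * ((B + norm x) * (B + norm w))"
    proof (rule tendsto_lowerbound)
      show "\<forall>\<^sub>F t in at_right 0. v \<bullet> w - F w - K \<le> t * ((B + norm x) * (B + norm w))"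
        using small by (auto simp: eventually_at_right_field intro!: exI[of _ 1])
    qed simp
    then show ?thesis by simp
  qed
  then show thesis using e by (intro that[of "e/2" K]) (auto simp: conj_le_iff)
qed

end

subsection \<open>Legendre functions\<close>

lemma has_gradient_unique:
  assumes "has_gradient g a x" "has_gradient g b x"
  shows "a = b"
proof -
  have "a \<bullet> (a - b) = b \<bullet> (a - b)"
    using assms unfolding has_gradient_def by (blast intro: DERIV_unique)
  then have "(a - b) \<bullet> (a - b) = 0" by (simp add: inner_diff_left)
  then show ?thesis by simp
qed

lemma grad_eq:
  assumes "has_gradient g a x"
  shows "grad g x = a"
  unfolding grad_def using assms by (blast intro: has_gradient_unique)

text \<open>Along the line, \<open>F\<close> minus the linear term of slope \<open>c\<close> has a
  local minimum at \<open>0\<close>; interiority admits both signs of \<open>t\<close>. This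
  identifies subgradients and later gives stationarity along \<open>S\<close>.\<close>

lemma (in closed_convex_function) gradient_inner_eq:
  assumes g: "has_gradient f g x"
    and min: "\<And>t. x + t *\<^sub>R h \<in> D \<Longrightarrow> F x + t * c \<le> F (x + t *\<^sub>R h)"
  shows "g \<bullet> h = c"
proof -
  obtain r where r: "0 < r" "ball x r \<subseteq> D"
    using g by (auto simp: has_gradient_def mem_interior)
  define d where "d = r / (norm h + 1)"
  have d: "0 < d" using r(1) by (simp add: d_def add_nonneg_pos)
  have "((\<lambda>t. F (x + t *\<^sub>R h) - t * c) has_real_derivative g \<bullet> h - c) (at 0)"
    using g unfolding has_gradient_def F_def by (auto intro!: derivative_eq_intros)
  then have "g \<bullet> h - c = 0"
  proof (rule DERIV_local_min[OF _ d], intro allI impI)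
    fix t :: real assume t: "\<bar>0 - t\<bar> < d"
    then have "\<bar>t\<bar> * (norm h + 1) < r"
      by (simp add: d_def pos_less_divide_eq add_nonneg_pos)
    then have "norm (t *\<^sub>R h) < r" by (simp add: algebra_simps)
    then have "x + t *\<^sub>R h \<in> D" using r by (auto simp: dist_norm)
    then show "F (x + 0 *\<^sub>R h) - 0 * c \<le> F (x + t *\<^sub>R h) - t * c" using min by force
  qed
  then show ?thesis by simp
qed

locale legendre_function = closed_convex_function +
  assumes legendre: "legendre f"
begin

lemma subdiff_dom: "subdiff_dom f = interior D"
  and gradient_exists: "x \<in> interior D \<Longrightarrow> \<exists>g. has_gradient f g x"
  and strictly_convex: "strictly_convex_on (interior D) f"
  using legendre convex_interior[OF convex_D]
  by (auto simp: legendre_def essentially_smooth_def essentially_strictly_convex_def)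

lemma gradient_blowup:
  assumes "\<And>k. s k \<in> interior D" "s \<longlonglongrightarrow> z" "z \<in> frontier D"
  shows "filterlim (\<lambda>k. norm (grad f (s k))) at_top sequentially"
  using legendre assms unfolding legendre_def essentially_smooth_def by blast

lemma subdiff_inv_locally_bounded:
  assumes "u \<in> subdiff f x"
  obtains e where "0 < e" "bounded (\<Union>v\<in>ball u e. subdiff_inv f v)"
proof -
  have "subdiff_inv f u \<noteq> {}" using assms by (auto simp: subdiff_inv_def)
  then show thesis
    using legendre that unfolding legendre_def essentially_strictly_convex_def by blast
qed

lemma interior_in_D: "x \<in> interior D \<Longrightarrow> x \<in> D"
  using interior_subset by blast

lemma has_gradient_grad: "x \<in> interior D \<Longrightarrow> has_gradient f (grad f x) x"
  using gradient_exists grad_eq by metis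

text \<open>Essential smoothness excludes subgradients at boundary points. At an interior point a
  subgradient supports \<open>F\<close> along every line, so its slope is the directional
  derivative.\<close>

lemma subdiff_imp_grad:
  assumes "u \<in> subdiff f x"
  shows "x \<in> interior D" "u = grad f x"
proof -
  show x: "x \<in> interior D" using assms subdiff_dom by (auto simp: subdiff_dom_def)
  have "grad f x \<bullet> h = u \<bullet> h" for h
  proof (rule gradient_inner_eq[OF has_gradient_grad[OF x]])
    show "F x + t * (u \<bullet> h) \<le> F (x + t *\<^sub>R h)" if "x + t *\<^sub>R h \<in> D" for t
      using assms that by (fastforce simp: subdiff_iff)
  qed
  then have "(u - grad f x) \<bullet> (u - grad f x) = 0" by (simp add: inner_diff_left)
  then show "u = grad f x" by simp
qed

lemma grad_in_subdiff:
  assumes "x \<in> interior D"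
  shows "grad f x \<in> subdiff f x"
  using assms subdiff_dom subdiff_imp_grad(2) unfolding subdiff_dom_def by blast

text \<open>The midpoint would do strictly better. The minimisers are taken in the interior because
  strict convexity is given on convex subsets of the subdifferential domain, which is
  \<open>interior D\<close>.\<close>

lemma minimizer_unique:
  assumes C: "convex C" and z: "z \<in> C \<inter> interior D" and w: "w \<in> C \<inter> interior D"
    and zmin: "\<And>c. c \<in> C \<inter> D \<Longrightarrow> F z - u \<bullet> z \<le> F c - u \<bullet> c"
    and wmin: "\<And>c. c \<in> C \<inter> D \<Longrightarrow> F w - u \<bullet> w \<le> F c - u \<bullet> c"
  shows "z = w"
proof (rule ccontr)
  assume "z \<noteq> w"
  define v where "v = (1 - 1/2) *\<^sub>R z + (1/2) *\<^sub>R w"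
  have zw: "z \<in> D" "w \<in> D" using z w interior_in_D by auto
  have "convex (C \<inter> D)" using C convex_D by (rule convex_Int)
  then have v: "v \<in> C \<inter> D"
    unfolding v_def by (rule convexD_alt) (use z w zw in auto)
  have "f v < ereal (1 - 1/2) * f z + ereal (1/2) * f w"
    unfolding v_def
    by (rule strictly_convex[unfolded strictly_convex_on_def, rule_format]) (use z w \<open>z \<noteq> w\<close> in auto)
  then have "F v < F z / 2 + F w / 2"
    using v zw by (simp add: f_eq_F)
  moreover have "u \<bullet> v = (u \<bullet> z) / 2 + (u \<bullet> w) / 2" by (simp add: v_def inner_add_right)
  ultimately show False using zmin[OF v] wmin[OF v] by linarith
qed

lemma subdiff_inv_unique:
  assumes "u \<in> subdiff f x" "u \<in> subdiff f z"
  shows "x = z"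
  using assms subdiff_imp_grad(1)
  by (intro minimizer_unique[of UNIV x z u]) (auto simp: subdiff_iff_minimizer)

section \<open>Differentiability of the conjugate\<close>

lemma conj_bounded_near_grad:
  assumes "x \<in> interior D"
  obtains r K where "0 < r" "\<And>v. v \<in> ball (grad f x) r \<Longrightarrow> fenchel_conj f v \<le> ereal K"
  using conj_locally_bounded[OF grad_in_subdiff[OF assms]]
    subdiff_inv_locally_bounded[OF grad_in_subdiff[OF assms]] by metis

lemma grad_in_interior_conj:
  assumes "x \<in> interior D"
  shows "grad f x \<in> interior (eff_dom (fenchel_conj f))"
proof -
  obtain r K where "0 < r" "\<And>v. v \<in> ball (grad f x) r \<Longrightarrow> fenchel_conj f v \<le> ereal K"
    using conj_bounded_near_grad[OF assms] by metis
  then show ?thesis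
    unfolding mem_interior eff_dom_def by (fastforce intro!: exI[of _ r])
qed

text \<open>The half-space \<open>C\<close> misses \<open>x\<close>. If it meets \<open>D\<close>,
  the tilted function attains its minimum over \<open>C \<inter> D\<close>, and uniqueness of the
  global minimiser makes that value strictly larger.\<close>

lemma almost_minimizers_near:
  assumes u: "u \<in> subdiff f x" and d: "0 < d"
  obtains e where "0 < e" "\<And>z. z \<in> D \<Longrightarrow> F z - u \<bullet> z \<le> F x - u \<bullet> x + e \<Longrightarrow> (z - x) \<bullet> h < d"
proof -
  define C where "C = {z. d + h \<bullet> x \<le> h \<bullet> z}"
  have C: "closed C" "convex C"
    unfolding C_def using closed_halfspace_ge convex_halfspace_ge by auto
  have inC: "(z - x) \<bullet> h < d" if "z \<notin> C" for z
    using that by (simp add: C_def inner_diff_right inner_commute[of _ h])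
  show thesis
  proof (cases "C \<inter> D = {}")
    case True
    then show thesis using inC by (intro that[of 1]) auto
  next
    case False
    obtain r K where rK: "0 < r" "\<And>v. v \<in> ball u r \<Longrightarrow> fenchel_conj f v \<le> ereal K"
      using conj_bounded_near_grad subdiff_imp_grad[OF u] by metis
    obtain z where z: "z \<in> C \<inter> D" "\<And>w. w \<in> C \<inter> D \<Longrightarrow> F z - u \<bullet> z \<le> F w - u \<bullet> w"
      using coercive_attains_minimum[OF rK(2) rK(1) C False] by metis
    have xmin: "F x - u \<bullet> x \<le> F w - u \<bullet> w" if "w \<in> D" for w
      using u that by (simp add: subdiff_iff_minimizer)
    \<comment> \<open>Half the gap between the two minima, so that points within \<open>e\<close> of
      the global minimum lie strictly below the minimum over \<open>C\<close>.\<close>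
    define e where "e = (F z - u \<bullet> z - (F x - u \<bullet> x)) / 2"
    have "z \<noteq> x" using z(1) d by (auto simp: C_def)
    moreover have "u \<in> subdiff f z" if "F z - u \<bullet> z \<le> F x - u \<bullet> x"
      using xmin that z(1) by (force simp: subdiff_iff_minimizer)
    ultimately have e: "0 < e" using subdiff_inv_unique[OF u] by (force simp: e_def)
    show thesis
    proof (rule that[OF e])
      fix w assume w: "w \<in> D" "F w - u \<bullet> w \<le> F x - u \<bullet> x + e"
      then have "F w - u \<bullet> w < F z - u \<bullet> z" using e by (simp add: e_def field_simps)
      then show "(w - x) \<bullet> h < d" using z(2)[of w] w(1) inC by fastforce
    qed
  qed
qed

text \<open>If \<open>u + t *\<^sub>R h\<close> is a subgradient at \<open>z\<close>, the
  first-order remainder of the conjugate lies between \<open>0\<close> and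
  \<open>t * ((z - x) \<bullet> h)\<close>. Such \<open>z\<close> stay bounded, hence almost
  minimise \<open>f\<close> tilted by \<open>u\<close> for small \<open>t\<close>, and are weakly
  close to \<open>x\<close>.\<close>

lemma has_gradient_conj:
  assumes x: "x \<in> interior D"
  shows "has_gradient (fenchel_conj f) x (grad f x)"
proof -
  define u where "u = grad f x"
  have u: "u \<in> subdiff f x" unfolding u_def using x by (rule grad_in_subdiff)
  have int: "u \<in> interior (eff_dom (fenchel_conj f))"
    unfolding u_def using x by (rule grad_in_interior_conj)
  obtain r where r: "0 < r" "ball u r \<subseteq> interior (eff_dom (fenchel_conj f))"
    using int open_interior open_contains_ball by blast
  obtain e where e: "0 < e" "bounded (\<Union>v\<in>ball u e. subdiff_inv f v)"
    using subdiff_inv_locally_bounded[OF u] by metis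
  obtain B where B: "\<And>z v. v \<in> ball u e \<Longrightarrow> v \<in> subdiff f z \<Longrightarrow> norm z \<le> B"
    using e(2) unfolding bounded_iff subdiff_inv_def by blast
  have B0: "0 \<le> B" using B[of u x] u e(1) by (auto intro: order_trans[OF norm_ge_zero])
  show ?thesis
    unfolding has_gradient_def u_def[symmetric]
  proof (intro conjI int allI)
    fix h
    define G where "G t = real_of_ereal (fenchel_conj f (u + t *\<^sub>R h))" for t
    have "\<exists>s>0. \<forall>t. t \<noteq> 0 \<and> \<bar>t\<bar> < s \<longrightarrow> \<bar>(G t - G 0) / t - x \<bullet> h\<bar> < d" if d: "0 < d" for d
    proof -
      obtain a b where a: "0 < a" "\<And>z. z \<in> D \<Longrightarrow> F z - u \<bullet> z \<le> F x - u \<bullet> x + a \<Longrightarrow> (z - x) \<bullet> h < d"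
        and b: "0 < b" "\<And>z. z \<in> D \<Longrightarrow> F z - u \<bullet> z \<le> F x - u \<bullet> x + b \<Longrightarrow> (z - x) \<bullet> (- h) < d"
        using almost_minimizers_near[OF u d] by metis
      define N where "N = norm h + 1"
      \<comment> \<open>The first bound keeps \<open>u + t *\<^sub>R h\<close> within
        \<open>r\<close> and \<open>e\<close> of \<open>u\<close>; the second keeps the excess of
        \<open>z\<close> over the minimum below \<open>a\<close> and \<open>b\<close>.\<close>
      define s where "s = min (min r e / N) (min a b / (N * (B + norm x + 1)))"
      have N: "0 < N" "norm h \<le> N" by (simp_all add: N_def add_nonneg_pos)
      have P: "0 < B + norm x + 1" using B0 by (simp add: add_nonneg_pos)
      have "0 < s" using r(1) e(1) a(1) b(1) N P by (simp add: s_def)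
      moreover have "\<bar>(G t - G 0) / t - x \<bullet> h\<bar> < d" if t: "t \<noteq> 0" "\<bar>t\<bar> < s" for t
      proof -
        have "\<bar>t\<bar> * norm h \<le> \<bar>t\<bar> * N" using N by (intro mult_left_mono) auto
        also have "\<bar>t\<bar> * N < min r e" using t(2) N by (simp add: s_def pos_less_divide_eq)
        finally have near: "norm (t *\<^sub>R h) < min r e" by simp
        then have "u + t *\<^sub>R h \<in> interior (eff_dom (fenchel_conj f))"
          using r(2) by (auto simp: dist_norm subset_iff)
        then obtain z where z: "u + t *\<^sub>R h \<in> subdiff f z" using subdiff_inv_nonempty by blast
        have zB: "norm z \<le> B" using near by (intro B[OF _ z]) (simp add: dist_norm)
        have zD: "z \<in> D" and 1: "F z + (u + t *\<^sub>R h) \<bullet> (x - z) \<le> F x"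
          and 2: "F x + u \<bullet> (z - x) \<le> F z"
          using z u by (auto simp: subdiff_iff)
        have "F z - u \<bullet> z \<le> F x - u \<bullet> x + t * ((z - x) \<bullet> h)"
          using 1 by (simp add: inner_add_left inner_diff_left inner_diff_right inner_commute algebra_simps)
        also have "t * ((z - x) \<bullet> h) \<le> \<bar>t\<bar> * \<bar>(z - x) \<bullet> h\<bar>"
          by (simp flip: abs_mult)
        also have "\<dots> \<le> \<bar>t\<bar> * (norm (z - x) * norm h)"
          by (intro mult_left_mono Cauchy_Schwarz_ineq2) auto
        also have "\<dots> \<le> \<bar>t\<bar> * ((B + norm x + 1) * N)"
          using zB norm_triangle_ineq4[of z x] N P by (intro mult_left_mono mult_mono) auto
        also have "\<dots> \<le> min a b"
          using t(2) N P by (simp add: s_def pos_less_divide_eq mult_ac)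
        finally have "F z - u \<bullet> z \<le> F x - u \<bullet> x + a" "F z - u \<bullet> z \<le> F x - u \<bullet> x + b"
          by simp_all
        from a(2)[OF zD this(1)] b(2)[OF zD this(2)]
        have close: "\<bar>(z - x) \<bullet> h\<bar> < d" by simp
        have G: "G t = (u + t *\<^sub>R h) \<bullet> z - F z" "G 0 = u \<bullet> x - F x"
          by (simp_all add: G_def conj_eq[OF z] conj_eq[OF u])
        have "0 \<le> G t - G 0 - t * (x \<bullet> h)" "G t - G 0 - t * (x \<bullet> h) \<le> t * ((z - x) \<bullet> h)"
          using 1 2 unfolding G
          by (simp_all add: inner_add_left inner_diff_left inner_diff_right inner_commute algebra_simps)
        then have "\<bar>G t - G 0 - t * (x \<bullet> h)\<bar> \<le> \<bar>t\<bar> * \<bar>(z - x) \<bullet> h\<bar>"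
          by (simp flip: abs_mult)
        also have "\<dots> < \<bar>t\<bar> * d" using t(1) close by simp
        finally have "\<bar>G t - G 0 - t * (x \<bullet> h)\<bar> / \<bar>t\<bar> < d"
          using t(1) by (simp add: pos_divide_less_eq mult.commute)
        then show ?thesis using t(1) by (simp add: diff_divide_distrib flip: abs_divide)
      qed
      ultimately show ?thesis by blast
    qed
    then have "(G has_real_derivative x \<bullet> h) (at 0)"
      unfolding DERIV_def LIM_def by (simp add: dist_real_def)
    then show "((\<lambda>t. real_of_ereal (fenchel_conj f (u + t *\<^sub>R h))) has_real_derivative x \<bullet> h) (at 0)"
      unfolding G_def .
  qed
qed

text \<open>The two gradients are mutually inverse: each interior point of the conjugate's domain is
  \<open>grad f z\<close> for some \<open>z\<close> in \<open>interior D\<close>, and the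
  conjugate's gradient sends it back to \<open>z\<close>.\<close>

lemma mem_grad_image_conj:
  assumes x: "x \<in> interior D"
  shows "x \<in> grad_image (fenchel_conj f) C \<longleftrightarrow> grad f x \<in> C"
proof
  assume "x \<in> grad_image (fenchel_conj f) C"
  then obtain u where u: "u \<in> C" "u \<in> interior (eff_dom (fenchel_conj f))"
    "x = grad (fenchel_conj f) u" by (auto simp: grad_image_def)
  obtain z where "u \<in> subdiff f z" using subdiff_inv_nonempty[OF u(2)] by blast
  note z = subdiff_imp_grad[OF this]
  have "x = z" using u(3) z grad_eq[OF has_gradient_conj[OF z(1)]] by simp
  then show "grad f x \<in> C" using u(1) z(2) by simp
next
  assume "grad f x \<in> C"
  then show "x \<in> grad_image (fenchel_conj f) C"
    using grad_in_interior_conj[OF x] grad_eq[OF has_gradient_conj[OF x]]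
    by (force simp: grad_image_def)
qed

text \<open>At a boundary minimiser the gradients along the segment towards \<open>x\<close> would stay bounded,
  because \<open>f\<close> is bounded above near \<open>x\<close>; this contradicts the gradient blow-up.\<close>
lemma minimizer_in_interior:
  assumes z: "z \<in> D" and x: "x \<in> interior D"
    and min: "\<And>t. 0 < t \<Longrightarrow> t \<le> 1 \<Longrightarrow> F z + t * (w \<bullet> (x - z)) \<le> F (z + t *\<^sub>R (x - z))"
  shows "z \<in> interior D"
proof (rule ccontr)
  assume "z \<notin> interior D"
  then have fr: "z \<in> frontier D" using z closure_subset by (auto simp: frontier_def)
  define t where "t k = 1 / real (Suc k)" for k
  define s where "s k = z + t k *\<^sub>R (x - z)" for k
  have t: "0 < t k" "t k \<le> 1" for k by (auto simp: t_def)
  have s: "s k \<in> interior D" for k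
    unfolding s_def using interior_convex_shrink[OF convex_D z x t] .
  have "s \<longlonglongrightarrow> z + 0 *\<^sub>R (x - z)"
    unfolding s_def t_def by (intro tendsto_intros LIMSEQ_inverse_real_of_nat[unfolded inverse_eq_divide])
  then have blowup: "filterlim (\<lambda>k. norm (grad f (s k))) at_top sequentially"
    by (intro gradient_blowup[OF s _ fr]) simp
  obtain r K where rK: "0 < r" "\<And>v. v \<in> ball x r \<Longrightarrow> f v \<le> ereal K"
    using locally_bounded_above[OF epi_convex epi_closed x] by metis
  have bound: "norm (grad f (s k)) \<le> (K - F z - w \<bullet> (x - z)) / (r/2)" for k
  proof -
    define g where "g = grad f (s k)"
    have sub: "F (s k) + g \<bullet> (v - s k) \<le> F v" if "v \<in> D" for v
      using grad_in_subdiff[OF s[of k]] that by (auto simp: subdiff_iff g_def)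
    \<comment> \<open>A point of the ball in the direction of \<open>g\<close>: the subgradient
      inequality tested there extracts \<open>r/2 * norm g\<close>, while
      \<open>F b \<le> K\<close>.\<close>
    define b where "b = x + (r/2) *\<^sub>R sgn g"
    have "b \<in> ball x r" using rK(1) by (simp add: b_def dist_norm norm_sgn)
    then have "b \<in> D" "F b \<le> K" using rK(2) by (auto simp: f_le_iff)
    moreover have "g \<bullet> b = g \<bullet> x + r/2 * norm g"
      by (cases "g = 0") (simp_all add: b_def inner_add_right sgn_div_norm
        dot_square_norm power2_eq_square)
    ultimately have "r/2 * norm g \<le> K - F (s k) - (1 - t k) * (g \<bullet> (x - z))"
      using sub[of b] by (simp add: s_def inner_diff_right inner_add_right algebra_simps)
    moreover have "F z + t k * (w \<bullet> (x - z)) \<le> F (s k)" unfolding s_def using min t by blast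
    moreover have "F (s k) - t k * (g \<bullet> (x - z)) \<le> F z"
      using sub[OF z] by (simp add: s_def)
    \<comment> \<open>\<open>min\<close> bounds \<open>F (s k)\<close> from below and the
      subgradient inequality at \<open>z\<close> bounds it from above; cancelling \<open>t k\<close>
      leaves a slope bound independent of \<open>k\<close>.\<close>
    moreover from calculation have "t k * (w \<bullet> (x - z)) \<le> t k * (g \<bullet> (x - z))" by linarith
    then have "w \<bullet> (x - z) \<le> g \<bullet> (x - z)" using t(1)[of k] by simp
    then have "(1 - t k) * (w \<bullet> (x - z)) \<le> (1 - t k) * (g \<bullet> (x - z))"
      using t(2)[of k] by (intro mult_left_mono) auto
    ultimately have "r/2 * norm g \<le> K - F z - t k * (w \<bullet> (x - z)) - (1 - t k) * (w \<bullet> (x - z))"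
      by linarith
    also have "\<dots> = K - F z - w \<bullet> (x - z)" by (simp add: algebra_simps)
    finally show ?thesis using rK(1) by (simp add: g_def field_simps)
  qed
  have "\<forall>\<^sub>F k in sequentially. (K - F z - w \<bullet> (x - z)) / (r/2) < norm (grad f (s k))"
    using blowup by (simp add: filterlim_at_top_dense)
  then obtain k where "(K - F z - w \<bullet> (x - z)) / (r/2) < norm (grad f (s k))"
    by (auto simp: eventually_sequentially)
  with bound[of k] show False by linarith
qed

section \<open>Bregman distances, projections and equidistance\<close>

lemma bregman_eq:
  assumes "y \<in> interior D" "x \<in> D"
  shows "bregman f x y = ereal (F x - F y - grad f y \<bullet> (x - y))"
  using assms by (simp add: bregman_def f_eq_F interior_in_D)

text \<open>The terms depending on \<open>y\<close> alone cancel, leaving \<open>F\<close> tilted by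
  \<open>grad f y\<close>; points outside \<open>D\<close> are at infinite distance.\<close>

lemma bregman_le_iff:
  assumes "y \<in> interior D" "u \<in> D"
  shows "bregman f u y \<le> bregman f c y \<longleftrightarrow>
    (c \<in> D \<longrightarrow> F u - grad f y \<bullet> u \<le> F c - grad f y \<bullet> c)"
proof (cases "c \<in> D")
  case True
  then show ?thesis using assms by (simp add: bregman_eq inner_diff_right)
next
  case False
  then have "bregman f c y = \<infinity>"
    using assms by (simp add: bregman_def f_eq_PInf f_eq_F interior_in_D)
  then show ?thesis using False by simp
qed

lemma bwd_proj_eq:
  assumes "y \<in> interior D"
  shows "bwd_proj f C y =
    {u \<in> C \<inter> D. \<forall>c\<in>C \<inter> D. F u - grad f y \<bullet> u \<le> F c - grad f y \<bullet> c}"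
  using bregman_le_iff[OF assms] by (auto simp: bwd_proj_def)

text \<open>Equidistance prescribes \<open>grad f z \<bullet> (q - a)\<close> by
  \<open>F q - F a\<close>, which does not involve \<open>z\<close>; subtracting the condition for
  \<open>y\<close> leaves a homogeneous one.\<close>

lemma fwd_equidist_iff:
  assumes S: "S \<subseteq> D" and a: "a \<in> S" and y: "y \<in> fwd_equidist f S"
  shows "x \<in> fwd_equidist f S \<longleftrightarrow>
    x \<in> interior D \<and> (\<forall>q\<in>S. (grad f x - grad f y) \<bullet> (q - a) = 0)"
proof -
  have E: "z \<in> fwd_equidist f S \<longleftrightarrow>
      z \<in> interior D \<and> (\<forall>q\<in>S. grad f z \<bullet> (q - a) = F q - F a)" for z
  proof (cases "z \<in> interior D")
    case True
    then have "bregman f p z = bregman f q z \<longleftrightarrow>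
        grad f z \<bullet> (p - a) - F p = grad f z \<bullet> (q - a) - F q" if "p \<in> S" "q \<in> S" for p q
      using that S by (auto simp: bregman_eq subset_iff inner_diff_right)
    then have "z \<in> fwd_equidist f S \<longleftrightarrow> (\<forall>p\<in>S. \<forall>q\<in>S.
        grad f z \<bullet> (p - a) - F p = grad f z \<bullet> (q - a) - F q)"
      using True by (simp add: fwd_equidist_def)
    also have "\<dots> \<longleftrightarrow> (\<forall>q\<in>S. grad f z \<bullet> (q - a) = F q - F a)"
    proof (intro iffI ballI)
      fix q assume "\<forall>p\<in>S. \<forall>q\<in>S. grad f z \<bullet> (p - a) - F p = grad f z \<bullet> (q - a) - F q" "q \<in> S"
      then have "grad f z \<bullet> (q - a) - F q = grad f z \<bullet> (a - a) - F a" using a by blast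
      then show "grad f z \<bullet> (q - a) = F q - F a" by simp
    qed simp
    finally show ?thesis using True by simp
  qed (simp add: fwd_equidist_def)
  show ?thesis using y unfolding E by (simp add: inner_diff_left)
qed

end

theorem theorem4p6:
  fixes f :: "'a::{real_inner, complete_space} \<Rightarrow> ereal"
    and p :: "nat \<Rightarrow> 'a" and m :: nat and S M :: "'a set" and y :: 'a
  assumes "f \<in> Gamma0" and "legendre f"
    and "m \<ge> 1"
    and "S = p ` {0..m}" and "S \<subseteq> eff_dom f"
    and "fwd_equidist f S \<noteq> {}" and "y \<in> fwd_equidist f S"
    and "M = span {p i - p 0 | i. i \<in> {1..m}}"
  shows "fwd_circumcenters f S =
           affine hull S \<inter> interior (eff_dom f) \<inter>
           grad_image (fenchel_conj f) ((\<lambda>v. grad f y + v) ` (M\<^sup>\<bottom>)) \<and>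
         (affine hull S \<inter> interior (eff_dom f) \<noteq> {} \<longrightarrow>
           (\<exists>u. bwd_proj f (affine hull S) y = {u} \<and> u \<in> fwd_circumcenters f S)) \<and>
         (eff_dom f = UNIV \<or> S \<inter> interior (eff_dom f) \<noteq> {} \<longrightarrow>
           affine hull S \<inter> interior (eff_dom f) \<noteq> {})"
proof -
  interpret legendre_function f
    using assms by unfold_locales
  have finS: "finite S" and p0: "p 0 \<in> S" using assms(4) by auto
  have y: "y \<in> interior D" using assms(7) by (simp add: fwd_equidist_def)
  note E = fwd_equidist_iff[OF assms(5) p0 assms(7)]
  have perp: "v \<in> M\<^sup>\<bottom> \<longleftrightarrow> (\<forall>q\<in>S. v \<bullet> (q - p 0) = 0)" for v
  proof -
    have "v \<in> M\<^sup>\<bottom> \<longleftrightarrow> (\<forall>w\<in>M. orthogonal v w)"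
      using orthogonal_commute by (auto simp: orthogonal_comp_def)
    also have "\<dots> \<longleftrightarrow> (\<forall>w\<in>{p i - p 0 | i. i \<in> {1..m}}. orthogonal v w)"
      unfolding assms(8) by (intro iffI ballI) (erule orthogonal_to_span | simp add: span_base)+
    also have "\<dots> \<longleftrightarrow> (\<forall>i\<in>{1..m}. v \<bullet> (p i - p 0) = 0)"
      unfolding orthogonal_def by blast
    \<comment> \<open>The index \<open>0\<close> contributes the zero vector; including it lets the
      condition range over all of \<open>S\<close>.\<close>
    also have "\<dots> \<longleftrightarrow> (\<forall>i\<in>insert 0 {1..m}. v \<bullet> (p i - p 0) = 0)" by simp
    also have "insert 0 {1..m} = {0..m}" by auto
    finally show ?thesis by (simp add: assms(4))
  qed
  have "x \<in> fwd_equidist f S \<longleftrightarrow>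
      x \<in> interior D \<inter> grad_image (fenchel_conj f) ((\<lambda>v. grad f y + v) ` (M\<^sup>\<bottom>))" for x
  proof (cases "x \<in> interior D")
    case True
    have "x \<in> fwd_equidist f S \<longleftrightarrow> grad f x - grad f y \<in> M\<^sup>\<bottom>" using True by (simp add: E perp)
    also have "\<dots> \<longleftrightarrow> grad f x \<in> (\<lambda>v. grad f y + v) ` (M\<^sup>\<bottom>)"
      by (auto intro!: image_eqI[of _ _ "grad f x - grad f y"])
    finally show ?thesis using True by (simp add: mem_grad_image_conj)
  qed (simp add: E)
  then have part1: "fwd_circumcenters f S = affine hull S \<inter> interior D \<inter>
      grad_image (fenchel_conj f) ((\<lambda>v. grad f y + v) ` (M\<^sup>\<bottom>))"
    by (auto simp: fwd_circumcenters_def)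
  have part2: "\<exists>u. bwd_proj f (affine hull S) y = {u} \<and> u \<in> fwd_circumcenters f S"
    if nonempty: "affine hull S \<inter> interior D \<noteq> {}"
  proof -
    define A where "A = affine hull S"
    define P where "P z \<longleftrightarrow> z \<in> A \<inter> D \<and> (\<forall>c\<in>A \<inter> D. F z - grad f y \<bullet> z \<le> F c - grad f y \<bullet> c)" for z
    have A: "affine A" "closed A" "S \<subseteq> A"
      using finS by (auto simp: A_def closed_affine_hull_finite hull_inc)
    note convA = affine_imp_convex[OF A(1)]
    obtain x where x: "x \<in> A" "x \<in> interior D" using nonempty by (auto simp: A_def)
    obtain r K where rK: "0 < r" "\<And>v. v \<in> ball (grad f y) r \<Longrightarrow> fenchel_conj f v \<le> ereal K"
      using conj_bounded_near_grad[OF y] by metis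
    have "A \<inter> D \<noteq> {}" using x interior_in_D by blast
    then obtain z where z: "P z"
      using coercive_attains_minimum[OF rK(2) rK(1) A(2) convA] unfolding P_def by metis
    \<comment> \<open>Used in two directions: towards \<open>x\<close>, to place minimisers in the
      interior, and along \<open>q - p 0\<close>, for stationarity.\<close>
    have slope: "F w + t * (grad f y \<bullet> h) \<le> F (w + t *\<^sub>R h)"
      if "P w" "w + t *\<^sub>R h \<in> A \<inter> D" for w t h
    proof -
      have "F w - grad f y \<bullet> w \<le> F (w + t *\<^sub>R h) - grad f y \<bullet> (w + t *\<^sub>R h)"
        using that unfolding P_def by blast
      then show ?thesis by (simp add: inner_add_right)
    qed
    have int: "w \<in> interior D" if w: "P w" for w
    proof (rule minimizer_in_interior[OF _ x(2), of _ "grad f y"])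
      show "w \<in> D" using w by (simp add: P_def)
      fix t :: real assume t: "0 < t" "t \<le> 1"
      have "w + t *\<^sub>R (x - w) = (1 - t) *\<^sub>R w + t *\<^sub>R x" by (simp add: algebra_simps)
      also have "\<dots> \<in> A \<inter> D"
        by (rule convexD_alt[OF convex_Int[OF convA convex_D]])
          (use w x t interior_in_D in \<open>auto simp: P_def\<close>)
      finally show "F w + t * (grad f y \<bullet> (x - w)) \<le> F (w + t *\<^sub>R (x - w))"
        by (rule slope[OF w])
    qed
    have "w = z" if w: "P w" for w
      using int[OF w] int[OF z] w z convA
      by (intro minimizer_unique[of A w z "grad f y"]) (auto simp: P_def)
    moreover have "bwd_proj f A y = {w. P w}" unfolding bwd_proj_eq[OF y] P_def by blast
    ultimately have "bwd_proj f A y = {z}" using z by blast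
    moreover have "(grad f z - grad f y) \<bullet> (q - p 0) = 0" if q: "q \<in> S" for q
    proof -
      have "grad f z \<bullet> (q - p 0) = grad f y \<bullet> (q - p 0)"
      proof (rule gradient_inner_eq[OF has_gradient_grad[OF int[OF z]]])
        fix t assume "z + t *\<^sub>R (q - p 0) \<in> D"
        \<comment> \<open>Differences of points of \<open>S\<close> are directions of the affine
          hull, so both signs of \<open>t\<close> occur and minimality becomes equality of
          slopes.\<close>
        moreover have "z + t *\<^sub>R (q - p 0) \<in> A"
          using A q p0 z by (intro mem_affine_3_minus) (auto simp: P_def)
        ultimately show "F z + t * (grad f y \<bullet> (q - p 0)) \<le> F (z + t *\<^sub>R (q - p 0))"
          using slope[OF z] by blast
      qed
      then show ?thesis by (simp add: inner_diff_left)
    qed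
    then have "z \<in> fwd_circumcenters f S"
      using z int[OF z] by (auto simp: fwd_circumcenters_def E P_def A_def)
    ultimately show ?thesis unfolding A_def by blast
  qed
  have part3: "affine hull S \<inter> interior D \<noteq> {}" if "D = UNIV \<or> S \<inter> interior D \<noteq> {}"
    using that p0 hull_inc[of _ S affine] by fastforce
  show ?thesis using part1 part2 part3 by blast
qed

end
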